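(* Let a fabric of kissing circles be given, let $s',t'$ be two adjacent frame circles of the fabric, and let $\gamma_0,\gamma_1$ be two touching (consecutive) circles of the fabric inscribed in the region bounded by $s'$ and $t'$. Let $\{\gamma_n\}_{n=-\infty}^{\infty}$ be the chain generated by the four circles $s',t',\gamma_0,\gamma_1$. Let $\kappa_{s'},\kappa_{t'}$ be the curvatures of $s',t'$, and for $n\in\mathbb{Z}$ let $\kappa_n$ be the curvature of $\gamma_n$. Then $$\kappa_n=\kappa_0+D\cdot n+\Delta\cdot n(n-1)\qquad\text{for all } n\in\mathbb{Z},$$ where $D=\kappa_1-\kappa_0$ and $\Delta=|\kappa_{t'}-\kappa_{s'}|$.
   Context: Construction of a fabric. Take an infinite square grid in the Euclidean plane (evenly spaced horizontal and vertical lines forming square cells) with a circle inscribed in each cell. Let $A$ be an arbitrary point of the plane and $\mathcal{C}$ a circle of radius $r>0$ centered at $A$. Apply to all lines and circles the inversion with respect to $\mathcal{C}$ (a point $X\ne A$ goes to the point $X'$ on the ray from $A$ through $X$ with $\overline{AX}\cdot\overline{AX'}=r^2$, and $A$ corresponds to the point at infinity). Each image is a generalized circle (a circle or a straight line), called simply a circle. Frames: the images of the vertical grid lines form the vertical frame and the images of the horizontal grid lines form the horizontal frame; their members are the frame circles, all passing through $A$. Two frame circles are adjacent if they are images of consecutive parallel grid lines; the region bounded by them is the image of the strip between these lines. Chains: the image of the doubly infinite column of inscribed circles between two consecutive vertical grid lines is a vertical chain, and the image of a row of inscribed circles between two consecutive horizontal grid lines is a horizontal chain. The circles of a chain are indexed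 by $\mathbb{Z}$ in their order along the column or row, so each is tangent to its two neighbors in the chain and to the two bounding frame circles (tangency being understood for generalized circles, so that parallel lines are tangent at infinity). The chain generated by $s',t',\gamma_0,\gamma_1$ is the chain in the region bounded by $s',t'$, indexed consecutively so that $\gamma_0,\gamma_1$ are its members with indices $0$ and $1$. The fabric of kissing circles is the union of the two frames and of all vertical and horizontal chains. Curvature (signed). A straight line has curvature $0$. Frame circles: in the coordinate system with origin $A$ and horizontal and vertical axes, a frame circle that is not a line is centered on one of the axes, and its curvature is $\pm1/(\text{radius})$ with the sign of the coordinate of its center on that axis. Chain circles: a chain circle that is not a line has curvature $1/(\text{radius})$, except that when it encloses the other circles it touches (which happens exactly when it is the image of an inscribed circle having $A$ in its interior), its curvature is $-1/(\text{radius})$. *)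

theory Defs
  imports "HOL-Analysis.Analysis"
begin

text \<open>
  The Euclidean plane is the type \<^typ>\<open>complex\<close>, with horizontal coordinate \<^const>\<open>Re\<close> and vertical
  coordinate \<^const>\<open>Im\<close>. Generalized circles are subsets of the plane extended by one point at
  infinity, which is represented by \<^const>\<open>None\<close>; every line contains it.
\<close>

type_synonym ext_plane = "complex option"

definition with_infinity :: "complex set \<Rightarrow> ext_plane set" where
  "with_infinity L = insert None (Some ` L)"

definition inversion :: "complex \<Rightarrow> real \<Rightarrow> ext_plane \<Rightarrow> ext_plane" where
  "inversion A r p = (case p of
     None \<Rightarrow> Some A
   | Some X \<Rightarrow> if X = A then None else Some (A + (r\<^sup>2 / (dist A X)\<^sup>2) *\<^sub>R (X - A)))"


subsection \<open>Generalized circles\<close>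

definition is_line :: "ext_plane set \<Rightarrow> bool" where
  "is_line S \<longleftrightarrow> (\<exists>a d. d \<noteq> 0 \<and> S = with_infinity (range (\<lambda>t::real. a + t *\<^sub>R d)))"

text \<open>Center and radius are meaningful only for generalized circles that are not lines.\<close>

definition circle_center :: "ext_plane set \<Rightarrow> complex" where
  "circle_center S = (THE c. \<exists>\<rho>>0. S = Some ` sphere c \<rho>)"

definition circle_radius :: "ext_plane set \<Rightarrow> real" where
  "circle_radius S = (THE \<rho>. \<rho> > 0 \<and> (\<exists>c. S = Some ` sphere c \<rho>))"

text \<open>
  The common point may be the point at infinity, so that parallel lines are tangent; two lines
  crossing in the plane have two common points, and a generalized circle is not tangent to itself.
\<close>

definition tangent :: "ext_plane set \<Rightarrow> ext_plane set \<Rightarrow> bool" where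
  "tangent S T \<longleftrightarrow> (\<exists>!p. p \<in> S \<and> p \<in> T)"


subsection \<open>The fabric\<close>

text \<open>
  The grid is given by one of its vertices and the side length of its cells, the circle of inversion
  by its center (the point \<open>A\<close>) and its radius.
\<close>

record fabric =
  grid_vertex :: complex
  cell_side :: real
  inv_center :: complex
  inv_radius :: real

definition is_fabric :: "fabric \<Rightarrow> bool" where
  "is_fabric F \<longleftrightarrow> cell_side F > 0 \<and> inv_radius F > 0"

definition vline_coord :: "fabric \<Rightarrow> int \<Rightarrow> real" where
  "vline_coord F i = Re (grid_vertex F) + of_int i * cell_side F"

definition hline_coord :: "fabric \<Rightarrow> int \<Rightarrow> real" where
  "hline_coord F j = Im (grid_vertex F) + of_int j * cell_side F"

text \<open>
  Cell \<open>(i, j)\<close> lies between the vertical lines \<open>i\<close>, \<open>i + 1\<close> and the horizontal lines \<open>j\<close>, \<open>j + 1\<close>.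
\<close>

definition inscribed_circle :: "fabric \<Rightarrow> int \<Rightarrow> int \<Rightarrow> complex set" where
  "inscribed_circle F i j =
     sphere (Complex (vline_coord F i + cell_side F / 2) (hline_coord F j + cell_side F / 2))
            (cell_side F / 2)"

definition invert :: "fabric \<Rightarrow> ext_plane set \<Rightarrow> ext_plane set" where
  "invert F S = inversion (inv_center F) (inv_radius F) ` S"

definition vframe :: "fabric \<Rightarrow> int \<Rightarrow> ext_plane set" where
  "vframe F i = invert F (with_infinity {z. Re z = vline_coord F i})"

definition hframe :: "fabric \<Rightarrow> int \<Rightarrow> ext_plane set" where
  "hframe F j = invert F (with_infinity {z. Im z = hline_coord F j})"

definition vchain :: "fabric \<Rightarrow> int \<Rightarrow> int \<Rightarrow> ext_plane set" where
  "vchain F i = (\<lambda>n. invert F (Some ` inscribed_circle F i n))"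

definition hchain :: "fabric \<Rightarrow> int \<Rightarrow> int \<Rightarrow> ext_plane set" where
  "hchain F j = (\<lambda>n. invert F (Some ` inscribed_circle F n j))"

definition fabric_circles :: "fabric \<Rightarrow> ext_plane set set" where
  "fabric_circles F =
     range (vframe F) \<union> range (hframe F) \<union> (\<Union>i. range (vchain F i)) \<union> (\<Union>j. range (hchain F j))"

definition adjacent_frames :: "fabric \<Rightarrow> ext_plane set \<Rightarrow> ext_plane set \<Rightarrow> bool" where
  "adjacent_frames F s t \<longleftrightarrow>
     (\<exists>i. {s, t} = {vframe F i, vframe F (i + 1)}) \<or> (\<exists>j. {s, t} = {hframe F j, hframe F (j + 1)})"

definition vregion :: "fabric \<Rightarrow> int \<Rightarrow> ext_plane set" where
  "vregion F i = invert F (with_infinity {z. vline_coord F i \<le> Re z \<and> Re z \<le> vline_coord F (i + 1)})"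

definition hregion :: "fabric \<Rightarrow> int \<Rightarrow> ext_plane set" where
  "hregion F j = invert F (with_infinity {z. hline_coord F j \<le> Im z \<and> Im z \<le> hline_coord F (j + 1)})"

definition inscribed_between ::
    "fabric \<Rightarrow> ext_plane set \<Rightarrow> ext_plane set \<Rightarrow> ext_plane set \<Rightarrow> bool" where
  "inscribed_between F s t S \<longleftrightarrow>
     tangent S s \<and> tangent S t \<and>
     ((\<exists>i. {s, t} = {vframe F i, vframe F (i + 1)} \<and> S \<subseteq> vregion F i) \<or>
      (\<exists>j. {s, t} = {hframe F j, hframe F (j + 1)} \<and> S \<subseteq> hregion F j))"

definition chain_between ::
    "fabric \<Rightarrow> ext_plane set \<Rightarrow> ext_plane set \<Rightarrow> (int \<Rightarrow> ext_plane set) \<Rightarrow> bool" where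
  "chain_between F s t c \<longleftrightarrow>
     (\<exists>i. {s, t} = {vframe F i, vframe F (i + 1)} \<and> c = vchain F i) \<or>
     (\<exists>j. {s, t} = {hframe F j, hframe F (j + 1)} \<and> c = hchain F j)"

text \<open>The circles \<open>g0\<close>, \<open>g1\<close> determine the starting point and the direction of the indexing.\<close>

definition generated_chain ::
    "fabric \<Rightarrow> ext_plane set \<Rightarrow> ext_plane set \<Rightarrow> ext_plane set \<Rightarrow> ext_plane set
      \<Rightarrow> (int \<Rightarrow> ext_plane set) \<Rightarrow> bool" where
  "generated_chain F s t g0 g1 g \<longleftrightarrow>
     (\<exists>c m. chain_between F s t c \<and> (g = (\<lambda>n. c (m + n)) \<or> g = (\<lambda>n. c (m - n)))) \<and>
     g 0 = g0 \<and> g 1 = g1"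


subsection \<open>Signed curvatures\<close>

text \<open>
  The center of a frame circle that is not a line lies on exactly one of the two axes through \<open>A\<close>,
  and differs from \<open>A\<close>.
\<close>

definition frame_curvature :: "fabric \<Rightarrow> ext_plane set \<Rightarrow> real" where
  "frame_curvature F S =
     (if is_line S then 0
      else let c = circle_center S - inv_center F
           in (if Im c = 0 then sgn (Re c) else sgn (Im c)) / circle_radius S)"

definition encloses_touching :: "fabric \<Rightarrow> ext_plane set \<Rightarrow> bool" where
  "encloses_touching F S \<longleftrightarrow>
     (\<forall>T \<in> fabric_circles F. tangent S T \<longrightarrow> T \<subseteq> Some ` cball (circle_center S) (circle_radius S))"

definition chain_curvature :: "fabric \<Rightarrow> ext_plane set \<Rightarrow> real" where
  "chain_curvature F S =
     (if is_line S then 0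
      else if encloses_touching F S then - 1 / circle_radius S
      else 1 / circle_radius S)"

end

theory Submission imports Defs begin

text \<open>
  A generalized circle is the zero set of \<open>a |w|\<^sup>2 - 2 b \<bullet> w + c\<close> with \<open>w = z - A\<close>, where the
  form takes the value \<open>a\<close> at infinity. Inversion about \<open>A\<close> exchanges \<open>a\<close> and \<open>c\<close>, up to powers of
  \<open>r\<close> and a positive factor, so it preserves the sides of a generalized circle as well. Hence a circle
  of radius \<open>\<rho>\<close> whose center has distance \<open>d\<close> from \<open>A\<close> acquires the signed curvature
  \<open>(d\<^sup>2 - \<rho>\<^sup>2) / (r\<^sup>2 \<rho>)\<close>, and a line at signed distance \<open>x\<close> the curvature \<open>2 x / r\<^sup>2\<close>. Along a chain
  \<open>d\<^sup>2\<close> is quadratic in the index, with leading coefficient \<open>s\<^sup>2 = 2 \<rho> s\<close> for the cell side \<open>s\<close>,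
  and \<open>2 \<rho> s / (r\<^sup>2 \<rho>) = 2 s / r\<^sup>2\<close> is the difference of the curvatures of the two frame circles.
\<close>

section \<open>Forms of generalized circles and the action of inversion on them\<close>

definition gen_form :: "complex \<Rightarrow> real \<Rightarrow> complex \<Rightarrow> real \<Rightarrow> ext_plane \<Rightarrow> real" where
  "gen_form A a b c p =
     (case p of None \<Rightarrow> a | Some X \<Rightarrow> a * (cmod (X - A))\<^sup>2 - 2 * (b \<bullet> (X - A)) + c)"

lemma gen_form_None [simp]: "gen_form A a b c None = a"
  by (simp add: gen_form_def)

lemma gen_form_Some:
  "gen_form A a b c (Some X) = a * (cmod (X - A))\<^sup>2 - 2 * (b \<bullet> (X - A)) + c"
  by (simp add: gen_form_def)

lemma inversion_involution:
  assumes "r > 0"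
  shows "inversion A r (inversion A r p) = p"
proof (cases p)
  case (Some X)
  show ?thesis
  proof (cases "X = A")
    case False
    define k where "k = r\<^sup>2 / (dist A X)\<^sup>2"
    have k: "k > 0" using False assms by (simp add: k_def)
    have "dist A (A + k *\<^sub>R (X - A)) = k * dist A X"
      using k by (simp add: dist_norm norm_minus_commute)
    moreover have "r\<^sup>2 / (k * dist A X)\<^sup>2 * k = 1"
      using False assms by (simp add: k_def field_simps power2_eq_square)
    ultimately show ?thesis
      using False k Some assms by (simp add: inversion_def flip: k_def)
  qed (simp add: inversion_def Some)
qed (simp add: inversion_def)

lemma inversion_image_iff:
  assumes "r > 0"
  shows "p \<in> inversion A r ` S \<longleftrightarrow> inversion A r p \<in> S"
  using inversion_involution[OF assms] by (metis image_iff)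

text \<open>Substituting r^2 w / |w|^2 for w = X - A exchanges the outer coefficients up to the
  factor 1 / |w|^2; at infinity the factor is 1, at \<open>A\<close> it is 1 / r^4. The factor
  depends on the point, but its positivity preserves the sign of the form, not only its
  zeros.\<close>

lemma gen_form_inversion:
  assumes "r > 0"
  obtains k where "k > 0"
    "gen_form A a b c (inversion A r p) = k * gen_form A c (r\<^sup>2 *\<^sub>R b) (r ^ 4 * a) p"
proof (cases p)
  case None
  with that[of 1] show ?thesis by (simp add: inversion_def gen_form_Some)
next
  case (Some X)
  show ?thesis
  proof (cases "X = A")
    case True
    with that[of "1 / r ^ 4"] assms Some show ?thesis
      by (simp add: inversion_def gen_form_Some)
  next
    case False
    define n where "n = cmod (X - A)"
    have n: "n > 0" using False by (simp add: n_def)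
    have dist: "dist A X = n"
      by (simp add: n_def dist_norm norm_minus_commute)
    have "gen_form A a b c (inversion A r p) =
        a * (r\<^sup>2 / n\<^sup>2 * n)\<^sup>2 - 2 * (r\<^sup>2 / n\<^sup>2 * (b \<bullet> (X - A))) + c"
      using False Some by (simp add: inversion_def gen_form_Some dist flip: n_def)
    also have "\<dots> = 1 / n\<^sup>2 * gen_form A c (r\<^sup>2 *\<^sub>R b) (r ^ 4 * a) p"
      unfolding Some gen_form_Some n_def[symmetric] inner_scaleR_left using n
      by (simp add: power_mult_distrib power_divide distrib_left right_diff_distrib)
         (simp add: power2_eq_square power4_eq_xxxx)
    finally show ?thesis using that[of "1 / n\<^sup>2"] n by simp
  qed
qed

lemma inversion_gen_circle:
  assumes "r > 0"
  shows "inversion A r ` {p. gen_form A a b c p = 0} =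
    {p. gen_form A c (r\<^sup>2 *\<^sub>R b) (r ^ 4 * a) p = 0}"
proof -
  have "gen_form A a b c (inversion A r p) = 0 \<longleftrightarrow>
      gen_form A c (r\<^sup>2 *\<^sub>R b) (r ^ 4 * a) p = 0" for p
    by (rule gen_form_inversion[OF assms, of A a b c p]) (simp only: mult_eq_0_iff, simp)
  then show ?thesis
    by (intro set_eqI) (simp only: inversion_image_iff[OF assms] mem_Collect_eq)
qed

lemma inversion_gen_disc:
  assumes "r > 0"
  shows "inversion A r ` {p. gen_form A a b c p \<ge> 0} =
    {p. gen_form A c (r\<^sup>2 *\<^sub>R b) (r ^ 4 * a) p \<ge> 0}"
proof -
  have "gen_form A a b c (inversion A r p) \<ge> 0 \<longleftrightarrow>
      gen_form A c (r\<^sup>2 *\<^sub>R b) (r ^ 4 * a) p \<ge> 0" for p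
    by (rule gen_form_inversion[OF assms, of A a b c p]) (simp only: zero_le_mult_iff, auto)
  then show ?thesis
    by (intro set_eqI) (simp only: inversion_image_iff[OF assms] mem_Collect_eq)
qed

section \<open>Circles, discs and lines described by forms\<close>

text \<open>The second hypothesis identifies the discriminant, which leaves center A + b / a and
  radius \<rho>. The sign of \<open>a\<close> stays free, so circles and discs can share the
  identity.\<close>

lemma gen_form_complete_square:
  assumes "a \<noteq> 0" "(cmod b)\<^sup>2 - a * c = (a * \<rho>)\<^sup>2"
  shows "gen_form A a b c (Some X) = a * ((dist (A + b /\<^sub>R a) X)\<^sup>2 - \<rho>\<^sup>2)"
proof -
  define w where "w = X - A"
  have "(dist (A + b /\<^sub>R a) X)\<^sup>2 = (cmod (w - b /\<^sub>R a))\<^sup>2"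
    unfolding w_def dist_norm norm_minus_commute[of _ X] by (simp only: diff_diff_eq)
  also have "\<dots> = (cmod w)\<^sup>2 - 2 * (b \<bullet> w) / a + (cmod b)\<^sup>2 / a\<^sup>2"
    unfolding power2_norm_eq_inner
    by (simp add: inner_diff_left inner_diff_right inner_commute divide_inverse power2_eq_square
        del: dot_square_norm)
  also have "(cmod b)\<^sup>2 / a\<^sup>2 = c / a + \<rho>\<^sup>2"
  proof -
    have "(cmod b)\<^sup>2 = a * c + (a * \<rho>)\<^sup>2"
      using assms(2) by simp
    then show ?thesis
      using assms(1) by (simp add: field_simps power2_eq_square)
  qed
  finally have "a * ((dist (A + b /\<^sub>R a) X)\<^sup>2 - \<rho>\<^sup>2) =
      a * ((cmod w)\<^sup>2 - 2 * (b \<bullet> w) / a + c / a)"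
    by simp
  then show ?thesis
    using assms(1) by (simp add: gen_form_Some w_def[symmetric] distrib_left right_diff_distrib)
qed

lemma gen_circle_eq_sphere:
  assumes "a \<noteq> 0" "(cmod b)\<^sup>2 - a * c = (a * \<rho>)\<^sup>2" "\<rho> > 0"
  shows "{p. gen_form A a b c p = 0} = Some ` sphere (A + b /\<^sub>R a) \<rho>"
proof -
  have "gen_form A a b c p = 0 \<longleftrightarrow> p \<in> Some ` sphere (A + b /\<^sub>R a) \<rho>" for p
  proof (cases p)
    case (Some X)
    show ?thesis
      using assms(1,3) unfolding Some gen_form_complete_square[OF assms(1,2)]
      by (auto simp: power2_eq_iff_nonneg)
  qed (use assms in auto)
  then show ?thesis by blast
qed

text \<open>For negative \<open>a\<close> the form is negative at infinity, so its nonnegative side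
  is the bounded one.\<close>

lemma gen_disc_eq_cball:
  assumes "a < 0" "(cmod b)\<^sup>2 - a * c = (a * \<rho>)\<^sup>2" "\<rho> > 0"
  shows "{p. gen_form A a b c p \<ge> 0} = Some ` cball (A + b /\<^sub>R a) \<rho>"
proof -
  have "gen_form A a b c p \<ge> 0 \<longleftrightarrow> p \<in> Some ` cball (A + b /\<^sub>R a) \<rho>" for p
  proof (cases p)
    case (Some X)
    show ?thesis
      using assms(1,3) unfolding Some gen_form_complete_square[OF less_imp_neq[OF assms(1)] assms(2)]
      by (auto simp: zero_le_mult_iff power2_le_iff_abs_le)
  qed (use assms in auto)
  then show ?thesis by blast
qed

text \<open>With leading coefficient 0 the equation is linear with normal vector \<open>b\<close>,
  and the form vanishes at infinity.\<close>

lemma is_line_gen_circle: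
  assumes "b \<noteq> 0"
  shows "is_line {p. gen_form A 0 b c p = 0}"
proof -
  define n where "n = (Re b)\<^sup>2 + (Im b)\<^sup>2"
  have n: "n > 0"
    using assms by (simp add: n_def complex_eq_iff sum_power2_gt_zero_iff)
  \<comment> \<open>\<open>a\<close> is the foot of the perpendicular from \<open>A\<close>, and
    \<open>d\<close> below is \<open>b\<close> turned by a right angle.\<close>
  define a where "a = A + (c / (2 * n)) *\<^sub>R b"
  define d where "d = Complex (- Im b) (Re b)"
  have "2 * (b \<bullet> (X - A)) = c \<longleftrightarrow> X \<in> range (\<lambda>t::real. a + t *\<^sub>R d)" for X
  proof
    assume *: "2 * (b \<bullet> (X - A)) = c"
    define t where "t = ((X - A) \<bullet> d) / n"
    have tn: "t * n = (X - A) \<bullet> d"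
      using n by (simp add: t_def)
    have c: "c / 2 = Re b * (Re X - Re A) + Im b * (Im X - Im A)"
      using * by (simp add: inner_complex_def)
    \<comment> \<open>This decomposes X - A along the orthogonal vectors \<open>b\<close> and
      \<open>d\<close>, multiplied by \<open>n\<close> = |b|^2 to avoid division.\<close>
    have "n * (Re X - Re A) = c / 2 * Re b + t * n * (- Im b)"
         "n * (Im X - Im A) = c / 2 * Im b + t * n * Re b"
      unfolding tn c by (simp_all add: n_def d_def inner_complex_def algebra_simps power2_eq_square)
    moreover have "n * (Re a + t * Re d - Re A) = c / 2 * Re b + t * n * (- Im b)"
         "n * (Im a + t * Im d - Im A) = c / 2 * Im b + t * n * Re b"
      using n by (simp_all add: a_def d_def right_diff_distrib distrib_left)
    ultimately have "n * (Re X - Re A) = n * (Re a + t * Re d - Re A)"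
         "n * (Im X - Im A) = n * (Im a + t * Im d - Im A)"
      by (simp_all only:)
    then have "X = a + t *\<^sub>R d"
      using n by (simp add: complex_eq_iff)
    then show "X \<in> range (\<lambda>t::real. a + t *\<^sub>R d)" by blast
  next
    assume "X \<in> range (\<lambda>t::real. a + t *\<^sub>R d)"
    then obtain t where "X = a + t *\<^sub>R d" by blast
    then have "X - A = (c / (2 * n)) *\<^sub>R b + t *\<^sub>R d"
      by (simp add: a_def)
    moreover have "b \<bullet> b = n" "b \<bullet> d = 0"
      by (simp_all add: n_def d_def inner_complex_def power2_eq_square)
    ultimately show "2 * (b \<bullet> (X - A)) = c"
      using n by (simp add: inner_add_right)
  qed
  moreover have "gen_form A 0 b c (Some X) = 0 \<longleftrightarrow> 2 * (b \<bullet> (X - A)) = c" for X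
    by (auto simp: gen_form_Some)
  moreover have "Some X \<in> with_infinity S \<longleftrightarrow> X \<in> S" "None \<in> with_infinity S" for X S
    by (auto simp: with_infinity_def)
  ultimately have "p \<in> {p. gen_form A 0 b c p = 0} \<longleftrightarrow>
      p \<in> with_infinity (range (\<lambda>t::real. a + t *\<^sub>R d))" for p
    by (cases p) (simp_all only: mem_Collect_eq gen_form_None simp_thms)
  then have "{p. gen_form A 0 b c p = 0} = with_infinity (range (\<lambda>t::real. a + t *\<^sub>R d))"
    by (rule set_eqI)
  moreover have "d \<noteq> 0"
    using assms by (auto simp: d_def complex_eq_iff)
  ultimately show ?thesis
    unfolding is_line_def by blast
qed

section \<open>Center and radius are determined by the circle\<close>

lemma not_is_line_circle: "\<not> is_line (Some ` S)"
  by (auto simp: is_line_def with_infinity_def)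

lemma sphere_complex_inject:
  fixes c c' :: complex
  assumes "\<rho> > 0" "\<rho>' > 0" "sphere c \<rho> = sphere c' \<rho>'"
  shows "c = c' \<and> \<rho> = \<rho>'"
proof -
  \<comment> \<open>Inclusion of circles compares their extreme points in the four axis directions.
    Using it in both directions turns these inequalities into equations for center and
    radius.\<close>
  have *: "Re c + \<rho> \<le> Re c' + \<rho>' \<and> Re c' - \<rho>' \<le> Re c - \<rho> \<and>
      Im c + \<rho> \<le> Im c' + \<rho>' \<and> Im c' - \<rho>' \<le> Im c - \<rho>"
    if "\<rho> > 0" "sphere c \<rho> \<subseteq> sphere c' \<rho>'" for c c' :: complex and \<rho> \<rho>'
  proof -
    have "c + \<rho> \<in> sphere c \<rho>" "c - \<rho> \<in> sphere c \<rho>"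
      "c + \<i> * \<rho> \<in> sphere c \<rho>" "c - \<i> * \<rho> \<in> sphere c \<rho>"
      using that(1) by (simp_all add: dist_norm norm_mult)
    then have "dist c' (c + \<rho>) = \<rho>'" "dist c' (c - \<rho>) = \<rho>'"
      "dist c' (c + \<i> * \<rho>) = \<rho>'" "dist c' (c - \<i> * \<rho>) = \<rho>'"
      using that(2) unfolding mem_sphere[symmetric] by blast+
    then show ?thesis
      using abs_Re_le_cmod[of "c' - (c + \<rho>)"] abs_Re_le_cmod[of "c' - (c - \<rho>)"]
        abs_Im_le_cmod[of "c' - (c + \<i> * \<rho>)"] abs_Im_le_cmod[of "c' - (c - \<i> * \<rho>)"]
      unfolding dist_norm by (simp add: abs_le_iff)
  qed
  show ?thesis
    using *[of \<rho> c c' \<rho>'] *[of \<rho>' c' c \<rho>] assms by (simp add: complex_eq_iff)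
qed

lemma circle_center_sphere:
  assumes "\<rho> > 0"
  shows "circle_center (Some ` sphere c \<rho>) = c"
  unfolding circle_center_def
  using assms sphere_complex_inject by (intro the_equality) (auto simp: inj_image_eq_iff)

lemma circle_radius_sphere:
  assumes "\<rho> > 0"
  shows "circle_radius (Some ` sphere c \<rho>) = \<rho>"
  unfolding circle_radius_def
  using assms sphere_complex_inject by (intro the_equality) (auto simp: inj_image_eq_iff)

section \<open>Images of circles, exteriors and lines under inversion\<close>

text \<open>The constant term is the power of \<open>A\<close> with respect to the circle. Inversion
  makes it the leading coefficient, so its sign decides the kind of the image.\<close>

lemma sphere_eq_gen_circle:
  assumes "\<rho> > 0"
  shows "Some ` sphere C \<rho> = {p. gen_form A 1 (C - A) ((dist A C)\<^sup>2 - \<rho>\<^sup>2) p = 0}"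
  using assms gen_circle_eq_sphere[of 1 "C - A" "(dist A C)\<^sup>2 - \<rho>\<^sup>2" \<rho> A]
  by (simp add: dist_norm norm_minus_commute)

text \<open>The exterior is the side of the form that contains infinity, where the value is 1. It is
  the region holding the other circles of the fabric.\<close>

lemma outside_sphere_eq_gen_disc:
  assumes "\<rho> > 0"
  shows "with_infinity (- ball C \<rho>) = {p. gen_form A 1 (C - A) ((dist A C)\<^sup>2 - \<rho>\<^sup>2) p \<ge> 0}"
proof -
  have "gen_form A 1 (C - A) ((dist A C)\<^sup>2 - \<rho>\<^sup>2) (Some X) = (dist C X)\<^sup>2 - \<rho>\<^sup>2" for X
    using gen_form_complete_square[of 1 "C - A" "(dist A C)\<^sup>2 - \<rho>\<^sup>2" \<rho> A X]
    by (simp add: dist_norm norm_minus_commute)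
  moreover have "\<rho> \<le> dist C X \<longleftrightarrow> \<rho>\<^sup>2 \<le> (dist C X)\<^sup>2" for X
    using assms by (simp add: power_mono_iff)
  moreover have "Some X \<in> with_infinity (- ball C \<rho>) \<longleftrightarrow> \<rho> \<le> dist C X" for X
    by (auto simp: with_infinity_def)
  ultimately have "p \<in> with_infinity (- ball C \<rho>) \<longleftrightarrow>
      gen_form A 1 (C - A) ((dist A C)\<^sup>2 - \<rho>\<^sup>2) p \<ge> 0" for p
    by (cases p) (simp_all add: with_infinity_def)
  then show ?thesis by blast
qed

text \<open>This is the discriminant condition for completing the square in the inverted form. The
  product \<open>r ^ 4 * 1\<close> is kept as inversion produces it.\<close>

lemma inverted_sphere_radius:
  assumes "e = (dist A C)\<^sup>2 - \<rho>\<^sup>2" "e \<noteq> 0"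
  shows "(cmod (r\<^sup>2 *\<^sub>R (C - A)))\<^sup>2 - e * (r ^ 4 * 1) = (e * (r\<^sup>2 * \<rho> / \<bar>e\<bar>))\<^sup>2"
proof -
  have "(cmod (r\<^sup>2 *\<^sub>R (C - A)))\<^sup>2 = r ^ 4 * (dist A C)\<^sup>2"
    by (simp add: dist_norm norm_minus_commute power_mult_distrib flip: power_mult)
  then have "(cmod (r\<^sup>2 *\<^sub>R (C - A)))\<^sup>2 - e * (r ^ 4 * 1) = r ^ 4 * \<rho>\<^sup>2"
    by (simp add: assms(1) algebra_simps)
  also have "\<dots> = (e * (r\<^sup>2 * \<rho> / \<bar>e\<bar>))\<^sup>2"
    using assms(2) by (simp add: power_mult_distrib power_divide flip: power_mult)
  finally show ?thesis .
qed

lemma inversion_sphere: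
  assumes "r > 0" "\<rho> > 0" "e = (dist A C)\<^sup>2 - \<rho>\<^sup>2" "e \<noteq> 0"
  shows "inversion A r ` Some ` sphere C \<rho> =
    Some ` sphere (A + (r\<^sup>2 / e) *\<^sub>R (C - A)) (r\<^sup>2 * \<rho> / \<bar>e\<bar>)"
proof -
  have "r\<^sup>2 * \<rho> / \<bar>e\<bar> > 0"
    using assms(1,2,4) by (intro divide_pos_pos mult_pos_pos) auto
  then show ?thesis
    unfolding sphere_eq_gen_circle[OF assms(2), of C A] inversion_gen_circle[OF assms(1)]
      assms(3)[symmetric]
    using gen_circle_eq_sphere[OF assms(4) inverted_sphere_radius[OF assms(3,4)], of r]
    by (simp add: divide_inverse mult.commute)
qed

text \<open>The power of \<open>A\<close> is zero here, so the leading coefficient of the image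
  vanishes.\<close>

lemma is_line_inversion_sphere:
  assumes "r > 0" "\<rho> > 0" "dist A C = \<rho>"
  shows "is_line (inversion A r ` Some ` sphere C \<rho>)"
proof -
  have "C \<noteq> A" using assms by auto
  then show ?thesis
    using assms is_line_gen_circle[of "r\<^sup>2 *\<^sub>R (C - A)" A "r ^ 4"]
    by (simp add: sphere_eq_gen_circle[of \<rho> C A] inversion_gen_circle)
qed

text \<open>When \<open>A\<close> is inside the circle, the power \<open>e\<close> is negative, and
  the unbounded exterior becomes a bounded disc.\<close>

lemma inversion_outside_sphere:
  assumes "r > 0" "\<rho> > 0" "e = (dist A C)\<^sup>2 - \<rho>\<^sup>2" "e < 0"
  shows "inversion A r ` with_infinity (- ball C \<rho>) =
    Some ` cball (A + (r\<^sup>2 / e) *\<^sub>R (C - A)) (r\<^sup>2 * \<rho> / \<bar>e\<bar>)"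
proof -
  have "r\<^sup>2 * \<rho> / \<bar>e\<bar> > 0"
    using assms(1,2,4) by (intro divide_pos_pos mult_pos_pos) auto
  then show ?thesis
    unfolding outside_sphere_eq_gen_disc[OF assms(2), of C A] inversion_gen_disc[OF assms(1)]
      assms(3)[symmetric]
    using gen_disc_eq_cball[OF assms(4) inverted_sphere_radius[OF assms(3)], of r] assms(4)
    by (simp add: divide_inverse mult.commute)
qed

lemma inversion_line:
  assumes "r > 0"
  shows "inversion A r ` with_infinity {z. b \<bullet> (z - A) = h} =
    {p. gen_form A (2 * h) (r\<^sup>2 *\<^sub>R b) 0 p = 0}"
proof -
  have "p \<in> with_infinity {z. b \<bullet> (z - A) = h} \<longleftrightarrow> gen_form A 0 b (2 * h) p = 0" for p
    by (cases p) (auto simp: with_infinity_def gen_form_Some)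
  then have "with_infinity {z. b \<bullet> (z - A) = h} = {p. gen_form A 0 b (2 * h) p = 0}"
    by blast
  then show ?thesis
    by (simp add: inversion_gen_circle[OF assms])
qed

section \<open>Signed curvatures of frame circles\<close>

text \<open>The two values of \<open>b\<close> cover vertical and horizontal lines, with
  \<open>h\<close> the signed distance from \<open>A\<close>. The center of the image lies on the
  axis of \<open>b\<close>, on the side given by the sign of \<open>h\<close>, so one signed formula
  holds, including the case of a line through \<open>A\<close>.\<close>

lemma frame_curvature_inverted_line:
  assumes "is_fabric F" "b = 1 \<or> b = \<i>"
  shows "frame_curvature F (invert F (with_infinity {z. b \<bullet> (z - inv_center F) = h})) =
    2 * h / (inv_radius F)\<^sup>2"
proof -
  define A r where "A = inv_center F" and "r = inv_radius F"
  have r: "r > 0" using assms(1) by (simp add: is_fabric_def r_def)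
  let ?S = "invert F (with_infinity {z. b \<bullet> (z - A) = h})"
  have S: "?S = {p. gen_form A (2 * h) (r\<^sup>2 *\<^sub>R b) 0 p = 0}"
    unfolding invert_def using inversion_line[OF r, of A b h] by (simp add: A_def r_def)
  show ?thesis
  proof (cases "h = 0")
    case True
    then have "is_line ?S"
      using S is_line_gen_circle[of "r\<^sup>2 *\<^sub>R b" A 0] r assms(2) by auto
    then show ?thesis
      using True by (simp add: frame_curvature_def A_def)
  next
    case False
    \<comment> \<open>The foot of the perpendicular from \<open>A\<close> goes to the point
      antipodal to \<open>A\<close>, at distance r^2 / |h|; this is half that diameter.\<close>
    define \<rho> where "\<rho> = r\<^sup>2 / (2 * \<bar>h\<bar>)"
    have \<rho>: "\<rho> > 0" using r False by (simp add: \<rho>_def)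
    have "cmod b = 1" using assms(2) by auto
    then have "(cmod (r\<^sup>2 *\<^sub>R b))\<^sup>2 - 2 * h * 0 = (2 * h * \<rho>)\<^sup>2"
      using False by (simp add: \<rho>_def power_mult_distrib power_divide)
    then have "?S = Some ` sphere (A + (r\<^sup>2 *\<^sub>R b) /\<^sub>R (2 * h)) \<rho>"
      using S gen_circle_eq_sphere[of "2 * h" "r\<^sup>2 *\<^sub>R b" 0 \<rho> A] False \<rho> by simp
    moreover define t where "t = r\<^sup>2 / (2 * h)"
    have "(r\<^sup>2 *\<^sub>R b) /\<^sub>R (2 * h) = t *\<^sub>R b"
      by (simp only: t_def scaleR_scaleR divide_inverse mult.commute)
    ultimately have S': "?S = Some ` sphere (A + t *\<^sub>R b) \<rho>"
      by (simp only:)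
    have t: "t \<noteq> 0" "sgn t = sgn h"
      using r False by (auto simp: t_def sgn_if zero_less_divide_iff divide_less_0_iff)
    \<comment> \<open>For \<open>b = \<i>\<close> the imaginary part of the center relative to
      \<open>A\<close> is \<open>t\<close>, and \<open>t \<noteq> 0\<close> selects the branch for
      the vertical axis.\<close>
    have "frame_curvature F ?S = sgn t / \<rho>"
      unfolding frame_curvature_def Let_def S' circle_center_sphere[OF \<rho>]
        circle_radius_sphere[OF \<rho>] A_def[symmetric]
      using assms(2) t(1) by (auto simp: not_is_line_circle)
    also have "\<dots> = sgn h / \<rho>"
      by (simp add: t(2))
    also have "\<dots> = 2 * h / r\<^sup>2"
      by (simp add: \<rho>_def sgn_if)
    finally show ?thesis by (simp add: A_def r_def)
  qed
qed

lemma frame_curvature_vframe: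
  assumes "is_fabric F"
  shows "frame_curvature F (vframe F i) =
    2 * (vline_coord F i - Re (inv_center F)) / (inv_radius F)\<^sup>2"
  using frame_curvature_inverted_line[OF assms, of 1 "vline_coord F i - Re (inv_center F)"]
  by (simp add: vframe_def inner_complex_def)

lemma frame_curvature_hframe:
  assumes "is_fabric F"
  shows "frame_curvature F (hframe F j) =
    2 * (hline_coord F j - Im (inv_center F)) / (inv_radius F)\<^sup>2"
  using frame_curvature_inverted_line[OF assms, of \<i> "hline_coord F j - Im (inv_center F)"]
  by (simp add: hframe_def inner_complex_def)

section \<open>Tangency, and the position of the other circles relative to one inscribed
  circle\<close>

lemma ex1_involution:
  assumes "\<And>p. f (f p) = p"
  shows "(\<exists>!p. P (f p)) \<longleftrightarrow> (\<exists>!p. P p)"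
proof
  assume "\<exists>!p. P (f p)"
  then obtain p where p: "P (f p)" "\<And>q. P (f q) \<Longrightarrow> q = p" by blast
  show "\<exists>!p. P p"
    by (rule ex1I[of _ "f p"]) (use p assms in metis)+
next
  assume "\<exists>!p. P p"
  then obtain p where p: "P p" "\<And>q. P q \<Longrightarrow> q = p" by blast
  show "\<exists>!p. P (f p)"
    by (rule ex1I[of _ "f p"]) (use p assms in metis)+
qed

text \<open>Inversion is a bijection of the extended plane, so it preserves the number of common
  points. Tangency can therefore be checked in the grid.\<close>

lemma tangent_invert_iff:
  assumes "is_fabric F"
  shows "tangent (invert F S) (invert F T) \<longleftrightarrow> tangent S T"
proof -
  have r: "inv_radius F > 0" using assms by (simp add: is_fabric_def)
  show ?thesis
    unfolding tangent_def invert_def inversion_image_iff[OF r]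
    by (rule ex1_involution[OF inversion_involution[OF r]])
qed

definition cell_center :: "fabric \<Rightarrow> int \<Rightarrow> int \<Rightarrow> complex" where
  "cell_center F i j =
     Complex (vline_coord F i + cell_side F / 2) (hline_coord F j + cell_side F / 2)"

lemma inscribed_circle_eq:
  "inscribed_circle F i j = sphere (cell_center F i j) (cell_side F / 2)"
  by (simp add: inscribed_circle_def cell_center_def)

lemma tangent_inscribed_circle_vline:
  assumes "is_fabric F"
  shows "tangent (Some ` inscribed_circle F i j) (with_infinity {z. Re z = vline_coord F i})"
proof -
  define s where "s = cell_side F"
  have s: "s > 0" using assms by (simp add: is_fabric_def s_def)
  let ?q = "Complex (vline_coord F i) (hline_coord F j + s / 2)"
  \<comment> \<open>On this line the horizontal offset from the center already equals the radius, so
    the vertical offset must vanish.\<close>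
  have *: "dist (cell_center F i j) z = s / 2 \<longleftrightarrow> z = ?q" if "Re z = vline_coord F i" for z
  proof -
    have "dist (cell_center F i j) z = s / 2 \<longleftrightarrow> (dist (cell_center F i j) z)\<^sup>2 = (s / 2)\<^sup>2"
      using s by (simp add: power2_eq_iff_nonneg)
    also have "\<dots> \<longleftrightarrow> Im z = hline_coord F j + s / 2"
      by (auto simp: dist_norm cmod_power2 cell_center_def that s_def)
    finally show ?thesis by (simp add: complex_eq_iff that)
  qed
  show ?thesis
    unfolding tangent_def
    by (rule ex1I[of _ "Some ?q"])
       (use * in \<open>auto simp: with_infinity_def inscribed_circle_eq s_def[symmetric]\<close>)
qed

text \<open>The offset is an odd multiple of s / 2, and an odd integer has absolute value at least
  1.\<close>

lemma abs_half_offset_ge: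
  fixes i k :: int and s x :: real
  assumes "s > 0"
  shows "\<bar>(x + of_int k * s) - (x + of_int i * s + s / 2)\<bar> \<ge> s / 2"
proof -
  define m where "m = 2 * (k - i) - 1"
  have "m \<noteq> 0" unfolding m_def by presburger
  then have "\<bar>real_of_int m\<bar> \<ge> 1" by linarith
  then have "s / 2 \<le> \<bar>s / 2 * of_int m\<bar>"
    using assms by (simp add: abs_mult)
  also have "s / 2 * of_int m = (x + of_int k * s) - (x + of_int i * s + s / 2)"
    by (simp add: m_def algebra_simps)
  finally show ?thesis .
qed

lemma dist_cell_center_ge:
  assumes "is_fabric F" "(i, j) \<noteq> (k, l)"
  shows "dist (cell_center F i j) (cell_center F k l) \<ge> cell_side F"
proof -
  define s where "s = cell_side F"
  have s: "s > 0" using assms by (simp add: is_fabric_def s_def)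
  have ge: "\<bar>real_of_int m * s\<bar> \<ge> s" if "m \<noteq> 0" for m
    using that s by (simp add: abs_mult)
  define w where "w = cell_center F i j - cell_center F k l"
  have "Re w = of_int (i - k) * s" "Im w = of_int (j - l) * s"
    by (simp_all add: w_def cell_center_def vline_coord_def hline_coord_def s_def algebra_simps)
  moreover have "i - k \<noteq> 0 \<or> j - l \<noteq> 0" using assms(2) by auto
  ultimately have "cmod w \<ge> s"
    using ge abs_Re_le_cmod[of w] abs_Im_le_cmod[of w] by (metis order_trans)
  then show ?thesis by (simp add: dist_norm w_def s_def)
qed

text \<open>Two opposite points are already two common points. This separates a chain circle from
  the circles that touch it.\<close>

lemma not_tangent_self_inscribed_circle:
  assumes "is_fabric F"
  shows "\<not> tangent (Some ` inscribed_circle F i j) (Some ` inscribed_circle F i j)"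
proof -
  define \<rho> C where "\<rho> = cell_side F / 2" and "C = cell_center F i j"
  have "\<rho> > 0" using assms by (simp add: is_fabric_def \<rho>_def)
  then have "C + of_real \<rho> \<in> sphere C \<rho>" "C - of_real \<rho> \<in> sphere C \<rho>"
      "C + of_real \<rho> \<noteq> C - of_real \<rho>"
    by (auto simp: dist_norm complex_eq_iff)
  then show ?thesis
    unfolding tangent_def inscribed_circle_eq C_def[symmetric] \<rho>_def[symmetric]
    by (metis imageI option.inject)
qed

text \<open>Before inversion, each grid line keeps distance at least s / 2 from the cell center in
  one coordinate. The center of another inscribed circle is at least s away, so its points are at
  least s / 2 away.\<close>

lemma fabric_circle_outside:
  assumes "is_fabric F" "T \<in> fabric_circles F" "T \<noteq> invert F (Some ` inscribed_circle F i j)"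
  shows "T \<subseteq> invert F (with_infinity (- ball (cell_center F i j) (cell_side F / 2)))"
proof -
  define s where "s = cell_side F"
  have s: "s > 0" using assms by (simp add: is_fabric_def s_def)
  let ?C = "cell_center F i j"
  have v: "{z. Re z = vline_coord F k} \<subseteq> - ball ?C (s / 2)" for k
  proof
    fix z assume "z \<in> {z. Re z = vline_coord F k}"
    then have "\<bar>Re (z - ?C)\<bar> \<ge> s / 2"
      using abs_half_offset_ge[OF s, of "Re (grid_vertex F)" k i]
      by (simp add: cell_center_def vline_coord_def s_def)
    then show "z \<in> - ball ?C (s / 2)"
      using abs_Re_le_cmod[of "z - ?C"] by (simp add: dist_norm norm_minus_commute)
  qed
  have h: "{z. Im z = hline_coord F k} \<subseteq> - ball ?C (s / 2)" for k
  proof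
    fix z assume "z \<in> {z. Im z = hline_coord F k}"
    then have "\<bar>Im (z - ?C)\<bar> \<ge> s / 2"
      using abs_half_offset_ge[OF s, of "Im (grid_vertex F)" k j]
      by (simp add: cell_center_def hline_coord_def s_def)
    then show "z \<in> - ball ?C (s / 2)"
      using abs_Im_le_cmod[of "z - ?C"] by (simp add: dist_norm norm_minus_commute)
  qed
  have c: "inscribed_circle F k l \<subseteq> - ball ?C (s / 2)" if "(i, j) \<noteq> (k, l)" for k l
  proof
    fix z assume "z \<in> inscribed_circle F k l"
    then have "dist (cell_center F k l) z = s / 2"
      by (simp add: inscribed_circle_eq s_def)
    then show "z \<in> - ball ?C (s / 2)"
      using dist_cell_center_ge[OF assms(1) that] dist_triangle[of ?C "cell_center F k l" z]
      by (simp add: dist_commute s_def)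
  qed
  have *: "invert F (with_infinity U) \<subseteq> invert F (with_infinity V)"
    "invert F (Some ` U) \<subseteq> invert F (with_infinity V)" if "U \<subseteq> V" for U V
    using that by (auto simp: invert_def with_infinity_def)
  consider k where "T = vframe F k" | k where "T = hframe F k"
    | k l where "T = invert F (Some ` inscribed_circle F k l)"
    using assms(2) unfolding fabric_circles_def vchain_def hchain_def by blast
  then show ?thesis
  proof cases
    case 1
    then show ?thesis using *(1)[OF v] by (simp add: vframe_def s_def)
  next
    case 2
    then show ?thesis using *(1)[OF h] by (simp add: hframe_def s_def)
  next
    case 3
    then have "(i, j) \<noteq> (k, l)" using assms(3) by auto
    with 3 show ?thesis using *(2)[OF c] by (simp add: s_def)
  qed
qed

section \<open>Signed curvatures of chain circles\<close>

text \<open>If \<open>A\<close> is inside the inscribed circle, the exterior containing the other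
  circles becomes the disc of the image. Conversely, a touching frame circle passes through
  \<open>A\<close>, so enclosure puts \<open>A\<close> into the image disc; comparing distances puts
  \<open>A\<close> into the original disc, and the hypothesis excludes its boundary.\<close>

lemma encloses_touching_iff:
  assumes "is_fabric F"
    and "dist (inv_center F) (cell_center F i j) \<noteq> cell_side F / 2"
  shows "encloses_touching F (invert F (Some ` inscribed_circle F i j)) \<longleftrightarrow>
    dist (inv_center F) (cell_center F i j) < cell_side F / 2"
proof -
  define A r C \<rho> where "A = inv_center F" and "r = inv_radius F"
    and "C = cell_center F i j" and "\<rho> = cell_side F / 2"
  note defs = A_def[symmetric] r_def[symmetric] C_def[symmetric] \<rho>_def[symmetric]
  define e where "e = (dist A C)\<^sup>2 - \<rho>\<^sup>2"
  have r: "r > 0" and \<rho>: "\<rho> > 0"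
    using assms by (simp_all add: is_fabric_def r_def \<rho>_def)
  have e0: "e \<noteq> 0" and e_neg: "e < 0 \<longleftrightarrow> dist A C < \<rho>"
    using assms(2) \<rho> power_mono_iff[of \<rho> "dist A C" 2]
    by (auto simp: e_def power2_eq_iff_nonneg not_le[symmetric] defs)
  define S C' \<rho>' where "S = invert F (Some ` inscribed_circle F i j)"
    and "C' = A + (r\<^sup>2 / e) *\<^sub>R (C - A)" and "\<rho>' = r\<^sup>2 * \<rho> / \<bar>e\<bar>"
  have \<rho>': "\<rho>' > 0" using r \<rho> e0 by (simp add: \<rho>'_def)
  have S: "S = Some ` sphere C' \<rho>'"
    using inversion_sphere[OF r \<rho> e_def e0]
    by (simp add: S_def invert_def inscribed_circle_eq C'_def \<rho>'_def defs)
  have enc: "encloses_touching F S \<longleftrightarrow>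
      (\<forall>T \<in> fabric_circles F. tangent S T \<longrightarrow> T \<subseteq> Some ` cball C' \<rho>')"
    unfolding encloses_touching_def S circle_center_sphere[OF \<rho>'] circle_radius_sphere[OF \<rho>'] ..
  have "encloses_touching F S \<longleftrightarrow> e < 0"
  proof
    assume "e < 0"
    then have "invert F (with_infinity (- ball C \<rho>)) = Some ` cball C' \<rho>'"
      using inversion_outside_sphere[OF r \<rho> e_def] by (simp add: invert_def C'_def \<rho>'_def defs)
    moreover have "T \<noteq> S" if "tangent S T" for T
      using that not_tangent_self_inscribed_circle[OF assms(1)] tangent_invert_iff[OF assms(1)]
      unfolding S_def by blast
    ultimately show "encloses_touching F S"
      using enc fabric_circle_outside[OF assms(1), of _ i j] by (simp add: S_def defs)
  next
    assume *: "encloses_touching F S"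
    have "tangent S (vframe F i)"
      unfolding S_def vframe_def tangent_invert_iff[OF assms(1)]
      by (rule tangent_inscribed_circle_vline[OF assms(1)])
    moreover have "vframe F i \<in> fabric_circles F"
      by (simp add: fabric_circles_def)
    ultimately have "vframe F i \<subseteq> Some ` cball C' \<rho>'"
      using * enc by blast
    \<comment> \<open>\<open>A\<close> is the image of the point at infinity, which lies on every
      grid line.\<close>
    moreover have "Some A \<in> vframe F i"
      by (force simp: vframe_def invert_def with_infinity_def inversion_def A_def)
    ultimately have "dist C' A \<le> \<rho>'" by auto
    moreover have "dist C' A = r\<^sup>2 * dist A C / \<bar>e\<bar>"
      by (simp add: C'_def dist_norm norm_minus_commute)
    ultimately have "dist A C \<le> \<rho>"
      using r e0 by (simp add: \<rho>'_def divide_le_cancel)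
    then show "e < 0" using assms(2) e_neg by (simp add: defs)
  qed
  then show ?thesis
    using e_neg by (simp add: S_def defs)
qed

text \<open>The power \<open>e\<close> of \<open>A\<close> vanishes exactly when the image is a line
  and is negative exactly when the image encloses the circles it touches. Dividing \<open>e\<close>
  by r^2 \<rho> thus gives the right sign in all cases.\<close>

lemma chain_curvature_inverted_inscribed_circle:
  assumes "is_fabric F"
  shows "chain_curvature F (invert F (Some ` inscribed_circle F i j)) =
    ((dist (inv_center F) (cell_center F i j))\<^sup>2 - (cell_side F / 2)\<^sup>2) /
    ((inv_radius F)\<^sup>2 * (cell_side F / 2))"
proof -
  define A r C \<rho> where "A = inv_center F" and "r = inv_radius F"
    and "C = cell_center F i j" and "\<rho> = cell_side F / 2"
  note defs = A_def[symmetric] r_def[symmetric] C_def[symmetric] \<rho>_def[symmetric]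
  define e where "e = (dist A C)\<^sup>2 - \<rho>\<^sup>2"
  define S where "S = invert F (Some ` inscribed_circle F i j)"
  have r: "r > 0" and \<rho>: "\<rho> > 0"
    using assms by (simp_all add: is_fabric_def r_def \<rho>_def)
  have S: "S = inversion A r ` Some ` sphere C \<rho>"
    by (simp add: S_def invert_def inscribed_circle_eq defs)
  have "chain_curvature F S = e / (r\<^sup>2 * \<rho>)"
  proof (cases "dist A C = \<rho>")
    case True
    then show ?thesis
      using is_line_inversion_sphere[OF r \<rho>] by (simp add: S chain_curvature_def e_def)
  next
    case False
    then have e0: "e \<noteq> 0" and e_neg: "e < 0 \<longleftrightarrow> dist A C < \<rho>"
      using \<rho> power_mono_iff[of \<rho> "dist A C" 2]
      by (auto simp: e_def power2_eq_iff_nonneg not_le[symmetric])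
    have S': "S = Some ` sphere (A + (r\<^sup>2 / e) *\<^sub>R (C - A)) (r\<^sup>2 * \<rho> / \<bar>e\<bar>)"
      using inversion_sphere[OF r \<rho> e_def e0] S by simp
    have "\<not> is_line S"
      unfolding S' by (rule not_is_line_circle)
    moreover have "circle_radius S = r\<^sup>2 * \<rho> / \<bar>e\<bar>"
      unfolding S' using r \<rho> e0 by (intro circle_radius_sphere) simp
    moreover have "encloses_touching F S \<longleftrightarrow> e < 0"
      using encloses_touching_iff[OF assms, of i j] False e_neg by (simp add: S_def defs)
    ultimately show ?thesis
      by (simp add: chain_curvature_def)
  qed
  then show ?thesis by (simp add: e_def S_def defs)
qed

section \<open>The quadratic law along a chain\<close>

text \<open>Only one coordinate of the cell center moves, in steps of s. The power of
  \<open>A\<close> is then quadratic with leading coefficient s^2, and division by r^2 s / 2 leaves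
  2 s / r^2. The coefficients \<open>p\<close> and \<open>q\<close> can stay unspecified.\<close>

lemma chain_curvature_chain:
  assumes "is_fabric F" "c = vchain F i \<or> c = hchain F i"
  obtains p q where "\<And>n. chain_curvature F (c n) =
    p + q * of_int n + 2 * cell_side F / (inv_radius F)\<^sup>2 * (of_int n)\<^sup>2"
proof -
  define s r where "s = cell_side F" and "r = inv_radius F"
  have s: "s > 0" and r: "r > 0"
    using assms(1) by (simp_all add: is_fabric_def s_def r_def)
  have quadratic: "((x\<^sup>2 + (y + of_int n * s)\<^sup>2) - (s / 2)\<^sup>2) / (r\<^sup>2 * (s / 2)) =
      (x\<^sup>2 + y\<^sup>2 - (s / 2)\<^sup>2) / (r\<^sup>2 * (s / 2)) + 4 * y / r\<^sup>2 * of_int n + 2 * s / r\<^sup>2 * (of_int n)\<^sup>2"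
    for x y n
    using s r by (simp add: field_simps power2_eq_square)
  define x y where "x = (\<lambda>i. vline_coord F i + s / 2 - Re (inv_center F))"
    and "y = (\<lambda>j. hline_coord F j + s / 2 - Im (inv_center F))"
  have \<kappa>: "chain_curvature F (invert F (Some ` inscribed_circle F i j)) =
      (((x i)\<^sup>2 + (y j)\<^sup>2) - (s / 2)\<^sup>2) / (r\<^sup>2 * (s / 2))" for i j
    unfolding chain_curvature_inverted_inscribed_circle[OF assms(1)] dist_commute[of "inv_center F"]
    by (simp add: dist_norm cmod_power2 cell_center_def x_def y_def s_def r_def)
  have xy: "x n = x 0 + of_int n * s" "y n = y 0 + of_int n * s" for n
    by (simp_all add: x_def y_def vline_coord_def hline_coord_def s_def)
  from assms(2) show ?thesis
  proof
    assume "c = vchain F i"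
    then show ?thesis
      using that \<kappa> xy(2) quadratic[of "x i" "y 0"] unfolding vchain_def s_def r_def by metis
  next
    assume "c = hchain F i"
    then show ?thesis
      using that \<kappa> xy(1) quadratic[of "y i" "x 0"] unfolding hchain_def s_def r_def
      \<comment> \<open>In a row the moving coordinate is the first of the two squares, in
        \<open>quadratic\<close> the second.\<close>
      by (metis add.commute)
  qed
qed

theorem theorem3p3:
  fixes F :: fabric
    and s' t' \<gamma>0 \<gamma>1 :: "ext_plane set"
    and \<gamma> :: "int \<Rightarrow> ext_plane set"
  assumes "is_fabric F"
    and "adjacent_frames F s' t'"
    and "\<gamma>0 \<in> fabric_circles F" and "inscribed_between F s' t' \<gamma>0"
    and "\<gamma>1 \<in> fabric_circles F" and "inscribed_between F s' t' \<gamma>1"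
    and "tangent \<gamma>0 \<gamma>1"
    and "generated_chain F s' t' \<gamma>0 \<gamma>1 \<gamma>"
  shows "let \<kappa> = (\<lambda>n. chain_curvature F (\<gamma> n));
             D = \<kappa> 1 - \<kappa> 0;
             \<Delta> = \<bar>frame_curvature F t' - frame_curvature F s'\<bar>
         in \<forall>n::int. \<kappa> n = \<kappa> 0 + D * of_int n + \<Delta> * (of_int n * (of_int n - 1))"
proof -
  define \<Delta> where "\<Delta> = 2 * cell_side F / (inv_radius F)\<^sup>2"
  have \<Delta>: "\<Delta> \<ge> 0" using assms(1) by (simp add: \<Delta>_def is_fabric_def)
  obtain c m where c: "chain_between F s' t' c"
    and \<gamma>: "\<gamma> = (\<lambda>n. c (m + n)) \<or> \<gamma> = (\<lambda>n. c (m - n))"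
    using assms(8) unfolding generated_chain_def by blast
  obtain i where i: "({s', t'} = {vframe F i, vframe F (i + 1)} \<and> c = vchain F i) \<or>
      ({s', t'} = {hframe F i, hframe F (i + 1)} \<and> c = hchain F i)"
    using c unfolding chain_between_def by blast
  have "frame_curvature F (vframe F (i + 1)) - frame_curvature F (vframe F i) = \<Delta>"
      "frame_curvature F (hframe F (i + 1)) - frame_curvature F (hframe F i) = \<Delta>"
    unfolding frame_curvature_vframe[OF assms(1)] frame_curvature_hframe[OF assms(1)]
    by (simp_all add: \<Delta>_def vline_coord_def hline_coord_def algebra_simps flip: diff_divide_distrib)
  \<comment> \<open>The pair of frame circles is unordered, so the difference is determined only up
    to sign; the absolute value removes this ambiguity.\<close>
  then have frame: "\<bar>frame_curvature F t' - frame_curvature F s'\<bar> = \<Delta>"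
    using i \<Delta> by (auto simp: doubleton_eq_iff)
  obtain p q where "\<And>n. chain_curvature F (c n) = p + q * of_int n + \<Delta> * (of_int n)\<^sup>2"
    using chain_curvature_chain[OF assms(1)] i unfolding \<Delta>_def by metis
  \<comment> \<open>Shifting or reversing the index keeps the leading coefficient \<Delta>. A
    quadratic with this leading coefficient is determined by its values at 0 and 1, and n(n - 1)
    vanishes at both.\<close>
  then show ?thesis
    using \<gamma> unfolding frame Let_def by (auto simp: algebra_simps power2_eq_square)
qed

end
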